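(* Let $R$ be a torsion-free Noetherian ring and $I$ a radical ideal of $R$. Then $$\omega_{R[[X]]}(I[[X]])=\omega_{R[X]}(I[X])=\omega_R(I).$$
   Context: All rings are commutative with identity. A ring $(R,+,\cdot)$ is torsion-free if $(R,+)$ is a torsion-free abelian group. An ideal $I$ is radical if $I=\sqrt{I}$. $X$ is an indeterminate; $I[X]$ (resp. $I[[X]]$) denotes the ideal of the polynomial ring $R[X]$ (resp. of the power series ring $R[[X]]$) consisting of all elements whose coefficients all lie in $I$. For a positive integer $n$, a proper ideal $I$ of a ring $R$ is $n$-absorbing if whenever $r_1\cdots r_{n+1}\in I$ with $r_1,\ldots,r_{n+1}\in R$, there are $n$ of the $r_i$'s whose product is in $I$. If $I$ is $n$-absorbing for some positive integer $n$, then $\omega_R(I)=\min\{n : I \text{ is an } n\text{-absorbing ideal of } R\}$; otherwise $\omega_R(I)=\infty$. *)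

theory Defs
  imports
    "HOL-Algebra.UnivPoly"
    "HOL-Algebra.Ring_Divisibility"
    "HOL-Library.Extended_Nat"
begin

definition torsion_free_ring :: "('a, 'm) ring_scheme \<Rightarrow> bool" where
  "torsion_free_ring R \<longleftrightarrow>
     (\<forall>n::nat. \<forall>x\<in>carrier R. n > 0 \<longrightarrow> [n] \<cdot>\<^bsub>R\<^esub> x = \<zero>\<^bsub>R\<^esub> \<longrightarrow> x = \<zero>\<^bsub>R\<^esub>)"

definition ideal_radical :: "('a, 'm) ring_scheme \<Rightarrow> 'a set \<Rightarrow> 'a set" where
  "ideal_radical R I = {x \<in> carrier R. \<exists>n::nat. n > 0 \<and> x [^]\<^bsub>R\<^esub> n \<in> I}"

definition radical_ideal :: "'a set \<Rightarrow> ('a, 'm) ring_scheme \<Rightarrow> bool" where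
  "radical_ideal I R \<longleftrightarrow> ideal I R \<and> I = ideal_radical R I"

definition n_absorbing_ideal :: "('a, 'm) ring_scheme \<Rightarrow> nat \<Rightarrow> 'a set \<Rightarrow> bool" where
  "n_absorbing_ideal R n I \<longleftrightarrow>
     n > 0 \<and> ideal I R \<and> I \<noteq> carrier R \<and>
     (\<forall>r. r \<in> {1..n+1} \<rightarrow> carrier R \<longrightarrow> (\<Otimes>\<^bsub>R\<^esub>i\<in>{1..n+1}. r i) \<in> I \<longrightarrow>
        (\<exists>S \<subseteq> {1..n+1}. card S = n \<and> (\<Otimes>\<^bsub>R\<^esub>i\<in>S. r i) \<in> I))"

definition absorbing_number :: "('a, 'm) ring_scheme \<Rightarrow> 'a set \<Rightarrow> enat" where
  "absorbing_number R I =
     (if \<exists>n. n_absorbing_ideal R n I then enat (LEAST n. n_absorbing_ideal R n I) else \<infinity>)"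

text \<open>
  A power series is its coefficient sequence, and the operations are those of
  \<^const>\<open>UP\<close> without the restriction to sequences of finite support.
\<close>

definition power_series_ring :: "('a, 'm) ring_scheme \<Rightarrow> (nat \<Rightarrow> 'a) ring" where
  "power_series_ring R = \<lparr>
     carrier = UNIV \<rightarrow> carrier R,
     mult = (\<lambda>p q n. \<Oplus>\<^bsub>R\<^esub>i\<in>{..n}. p i \<otimes>\<^bsub>R\<^esub> q (n - i)),
     one = (\<lambda>i. if i = 0 then \<one>\<^bsub>R\<^esub> else \<zero>\<^bsub>R\<^esub>),
     zero = (\<lambda>i. \<zero>\<^bsub>R\<^esub>),
     add = (\<lambda>p q i. p i \<oplus>\<^bsub>R\<^esub> q i)\<rparr>"

definition poly_ideal :: "('a, 'm) ring_scheme \<Rightarrow> 'a set \<Rightarrow> (nat \<Rightarrow> 'a) set" where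
  "poly_ideal R I = {p \<in> carrier (UP R). \<forall>n. coeff (UP R) p n \<in> I}"

definition power_series_ideal :: "('a, 'm) ring_scheme \<Rightarrow> 'a set \<Rightarrow> (nat \<Rightarrow> 'a) set" where
  "power_series_ideal R I = {p \<in> carrier (power_series_ring R). \<forall>n. p n \<in> I}"

context cring
begin

text \<open>
  The \<open>n\<close>-th coefficient of a product depends only on the truncations of the factors to
  degree \<open>n\<close>, which are polynomials; so the ring laws carry over from \<^const>\<open>UP\<close>.
\<close>

definition ps_trunc :: "nat \<Rightarrow> (nat \<Rightarrow> 'a) \<Rightarrow> nat \<Rightarrow> 'a" where
  "ps_trunc n p = (\<lambda>i. if i \<le> n then p i else \<zero>)"

lemma ps_trunc_closed: "p \<in> UNIV \<rightarrow> carrier R \<Longrightarrow> ps_trunc n p \<in> carrier (UP R)"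
  by (auto simp: ps_trunc_def UP_def up_def Pi_def intro!: exI[of _ n] bound.intro)

lemma ps_mult_closed:
  "p \<in> carrier (power_series_ring R) \<Longrightarrow> q \<in> carrier (power_series_ring R) \<Longrightarrow>
   p \<otimes>\<^bsub>power_series_ring R\<^esub> q \<in> carrier (power_series_ring R)"
  by (auto simp: power_series_ring_def Pi_def intro!: finsum_closed)

lemma ps_mult_trunc:
  assumes "p \<in> carrier (power_series_ring R)" "q \<in> carrier (power_series_ring R)" "i \<le> n"
  shows "(p \<otimes>\<^bsub>power_series_ring R\<^esub> q) i = (ps_trunc n p \<otimes>\<^bsub>UP R\<^esub> ps_trunc n q) i"
proof -
  have pq: "\<And>i. p i \<in> carrier R" "\<And>i. q i \<in> carrier R"
    using assms by (auto simp: power_series_ring_def)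
  then have "ps_trunc n p \<in> up R" "ps_trunc n q \<in> up R"
    using ps_trunc_closed by (auto simp: UP_def)
  then have "(ps_trunc n p \<otimes>\<^bsub>UP R\<^esub> ps_trunc n q) i =
      (\<Oplus>j\<in>{..i}. ps_trunc n p j \<otimes> ps_trunc n q (i - j))"
    by (simp add: UP_def)
  also have "\<dots> = (\<Oplus>j\<in>{..i}. p j \<otimes> q (i - j))"
    using pq assms(3) by (intro finsum_cong') (auto simp: ps_trunc_def)
  finally show ?thesis
    by (simp add: power_series_ring_def)
qed

lemma UP_mult_coeff_cong:
  assumes "p \<in> carrier (UP R)" "q \<in> carrier (UP R)" "p' \<in> carrier (UP R)" "q' \<in> carrier (UP R)"
    and "\<And>i. i \<le> n \<Longrightarrow> p i = p' i" "\<And>i. i \<le> n \<Longrightarrow> q i = q' i"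
  shows "(p \<otimes>\<^bsub>UP R\<^esub> q) n = (p' \<otimes>\<^bsub>UP R\<^esub> q') n"
proof -
  have "(\<Oplus>j\<in>{..n}. p j \<otimes> q (n - j)) = (\<Oplus>j\<in>{..n}. p' j \<otimes> q' (n - j))"
    using assms by (intro finsum_cong') (auto simp: UP_def)
  then show ?thesis
    using assms(1-4) by (simp add: UP_def)
qed

lemma power_series_ring_cring: "cring (power_series_ring R)"
proof -
  interpret U: UP_cring R "UP R"
    by unfold_locales
  let ?S = "power_series_ring R"
  have carr: "p \<in> carrier ?S \<longleftrightarrow> (\<forall>i. p i \<in> carrier R)" for p
    by (auto simp: power_series_ring_def)
  have tc: "ps_trunc n p \<in> carrier (UP R)" if "p \<in> carrier ?S" for n p
    using that ps_trunc_closed by (auto simp: power_series_ring_def)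
  have addS: "(p \<oplus>\<^bsub>?S\<^esub> q) = (\<lambda>i. p i \<oplus> q i)" for p q
    by (simp add: power_series_ring_def)
  have oneS: "\<one>\<^bsub>?S\<^esub> \<in> carrier ?S" "ps_trunc n \<one>\<^bsub>?S\<^esub> = \<one>\<^bsub>UP R\<^esub>" for n
    by (auto simp: power_series_ring_def ps_trunc_def UP_def)
  have trunc_le: "ps_trunc n p i = p i" if "i \<le> n" for n p i
    using that by (simp add: ps_trunc_def)
  have assoc: "(x \<otimes>\<^bsub>?S\<^esub> y) \<otimes>\<^bsub>?S\<^esub> z = x \<otimes>\<^bsub>?S\<^esub> (y \<otimes>\<^bsub>?S\<^esub> z)"
    if "x \<in> carrier ?S" "y \<in> carrier ?S" "z \<in> carrier ?S" for x y z
  proof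
    fix n
    let ?t = "ps_trunc n"
    have "((x \<otimes>\<^bsub>?S\<^esub> y) \<otimes>\<^bsub>?S\<^esub> z) n = (?t (x \<otimes>\<^bsub>?S\<^esub> y) \<otimes>\<^bsub>UP R\<^esub> ?t z) n"
      using that by (simp add: ps_mult_trunc ps_mult_closed)
    also have "\<dots> = ((?t x \<otimes>\<^bsub>UP R\<^esub> ?t y) \<otimes>\<^bsub>UP R\<^esub> ?t z) n"
      using that by (intro UP_mult_coeff_cong) (auto simp: tc ps_mult_closed trunc_le ps_mult_trunc)
    also have "\<dots> = (?t x \<otimes>\<^bsub>UP R\<^esub> (?t y \<otimes>\<^bsub>UP R\<^esub> ?t z)) n"
      using that by (simp add: tc U.P.m_assoc)
    also have "\<dots> = (?t x \<otimes>\<^bsub>UP R\<^esub> ?t (y \<otimes>\<^bsub>?S\<^esub> z)) n"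
      using that by (intro UP_mult_coeff_cong) (auto simp: tc ps_mult_closed trunc_le ps_mult_trunc)
    also have "\<dots> = (x \<otimes>\<^bsub>?S\<^esub> (y \<otimes>\<^bsub>?S\<^esub> z)) n"
      using that by (intro ps_mult_trunc[symmetric]) (auto simp: ps_mult_closed)
    finally show "((x \<otimes>\<^bsub>?S\<^esub> y) \<otimes>\<^bsub>?S\<^esub> z) n = (x \<otimes>\<^bsub>?S\<^esub> (y \<otimes>\<^bsub>?S\<^esub> z)) n" .
  qed
  have comm: "x \<otimes>\<^bsub>?S\<^esub> y = y \<otimes>\<^bsub>?S\<^esub> x" if "x \<in> carrier ?S" "y \<in> carrier ?S" for x y
  proof
    fix n
    show "(x \<otimes>\<^bsub>?S\<^esub> y) n = (y \<otimes>\<^bsub>?S\<^esub> x) n"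
      using that by (simp add: ps_mult_trunc[where n = n] tc U.P.m_comm)
  qed
  have one: "\<one>\<^bsub>?S\<^esub> \<otimes>\<^bsub>?S\<^esub> x = x" if "x \<in> carrier ?S" for x
  proof
    fix n
    show "(\<one>\<^bsub>?S\<^esub> \<otimes>\<^bsub>?S\<^esub> x) n = x n"
      using that by (simp add: ps_mult_trunc[where n = n] tc oneS trunc_le)
  qed
  have distr: "(x \<oplus>\<^bsub>?S\<^esub> y) \<otimes>\<^bsub>?S\<^esub> z = x \<otimes>\<^bsub>?S\<^esub> z \<oplus>\<^bsub>?S\<^esub> y \<otimes>\<^bsub>?S\<^esub> z"
    if "x \<in> carrier ?S" "y \<in> carrier ?S" "z \<in> carrier ?S" for x y z
  proof
    fix n
    have "(\<Oplus>i\<in>{..n}. (x i \<oplus> y i) \<otimes> z (n - i)) =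
        (\<Oplus>i\<in>{..n}. x i \<otimes> z (n - i) \<oplus> y i \<otimes> z (n - i))"
      using that by (intro finsum_cong') (auto simp: carr l_distr)
    also have "\<dots> = (\<Oplus>i\<in>{..n}. x i \<otimes> z (n - i)) \<oplus> (\<Oplus>i\<in>{..n}. y i \<otimes> z (n - i))"
      using that by (intro finsum_addf) (auto simp: carr)
    finally show "((x \<oplus>\<^bsub>?S\<^esub> y) \<otimes>\<^bsub>?S\<^esub> z) n = (x \<otimes>\<^bsub>?S\<^esub> z \<oplus>\<^bsub>?S\<^esub> y \<otimes>\<^bsub>?S\<^esub> z) n"
      by (simp add: power_series_ring_def)
  qed
  have "abelian_group ?S"
  proof (rule abelian_groupI)
    fix x assume x: "x \<in> carrier ?S"
    then have "(\<lambda>i. \<ominus> x i) \<in> carrier ?S" "(\<lambda>i. \<ominus> x i) \<oplus>\<^bsub>?S\<^esub> x = \<zero>\<^bsub>?S\<^esub>"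
      by (auto simp: power_series_ring_def l_neg Pi_def)
    then show "\<exists>y\<in>carrier ?S. y \<oplus>\<^bsub>?S\<^esub> x = \<zero>\<^bsub>?S\<^esub>"
      by blast
  qed (auto simp: power_series_ring_def Pi_def a_ac)
  moreover have "Group.comm_monoid ?S"
    using assoc comm one oneS(1) by (intro comm_monoidI) (auto simp: ps_mult_closed)
  ultimately show ?thesis
    using distr by (intro cringI)
qed

lemma power_series_ideal_ideal:
  assumes "ideal I R"
  shows "ideal (power_series_ideal R I) (power_series_ring R)"
proof -
  interpret I: ideal I R by fact
  interpret S: cring "power_series_ring R" by (rule power_series_ring_cring)
  let ?S = "power_series_ring R" and ?J = "power_series_ideal R I"
  have carr: "p \<in> carrier ?S \<longleftrightarrow> (\<forall>i. p i \<in> carrier R)" for p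
    by (auto simp: power_series_ring_def)
  have J: "p \<in> ?J \<longleftrightarrow> (\<forall>i. p i \<in> I)" for p
    by (auto simp: power_series_ideal_def carr I.Icarr)
  have sum_in: "(\<Oplus>i\<in>{..n::nat}. f i) \<in> I" if "\<And>i. f i \<in> I" for f n
    using that by (induction n) (simp_all add: I.Icarr I.a_closed Pi_def)
  have mult_in: "x \<otimes>\<^bsub>?S\<^esub> p \<in> ?J" if "p \<in> ?J" "x \<in> carrier ?S" for x p
    unfolding J using that[unfolded J carr]
    by (auto simp: power_series_ring_def intro!: sum_in I.I_l_closed)
  have inv: "\<ominus>\<^bsub>?S\<^esub> p = (\<lambda>i. \<ominus> p i)" if "p \<in> carrier ?S" for p
  proof (rule S.minus_equality)
    show "(\<lambda>i. \<ominus> p i) \<oplus>\<^bsub>?S\<^esub> p = \<zero>\<^bsub>?S\<^esub>"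
      using that by (simp add: power_series_ring_def l_neg Pi_def)
  qed (use that in \<open>auto simp: carr\<close>)
  show ?thesis
  proof (rule idealI)
    show "subgroup ?J (add_monoid ?S)"
    proof (rule S.a_group[THEN group.subgroupI])
      show "?J \<subseteq> carrier (add_monoid ?S)"
        by (auto simp: power_series_ideal_def)
      have "\<zero>\<^bsub>?S\<^esub> \<in> ?J"
        by (simp add: J power_series_ring_def)
      then show "?J \<noteq> {}"
        by blast
      show "inv\<^bsub>add_monoid ?S\<^esub> p \<in> ?J" if "p \<in> ?J" for p
      proof -
        have "\<ominus>\<^bsub>?S\<^esub> p \<in> ?J"
          using that by (simp add: inv J carr I.Icarr)
        then show ?thesis
          by (simp only: a_inv_def)
      qed
      show "p \<otimes>\<^bsub>add_monoid ?S\<^esub> q \<in> ?J" if "p \<in> ?J" "q \<in> ?J" for p q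
        using that by (simp add: J) (simp add: power_series_ring_def)
    qed
    show "x \<otimes>\<^bsub>?S\<^esub> p \<in> ?J" if "p \<in> ?J" "x \<in> carrier ?S" for x p
      using that by (rule mult_in)
    show "p \<otimes>\<^bsub>?S\<^esub> x \<in> ?J" if "p \<in> ?J" "x \<in> carrier ?S" for x p
      using mult_in[OF that] that S.m_comm[of p x] by (simp add: power_series_ideal_def)
  qed (rule S.ring_axioms)
qed

end

end

theory Submission
  imports Defs "HOL-Algebra.QuotRing"
begin

text \<open>
  For a finite set of pairwise incomparable primes, the absorbing number of their intersection is
  the number of primes (\<open>absorbing_number_Inter_primes\<close>). A product lies in the intersection iff
  every prime contains one of its factors, so choosing one such factor for each prime keeps the
  product in the intersection, and this bounds the absorbing number from above. The bound is
  attained: there are elements, as many as there are primes, such that each of them lies in exactly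
  one of the primes and each prime contains exactly one of them. Their product is in the
  intersection, but leaving out any factor takes it out of the corresponding prime.

  A radical ideal \<open>I\<close> of a Noetherian ring is the intersection of finitely many primes
  (\<open>noetherian_semiprime_Inter_primes\<close>), and the minimal ones among them are pairwise incomparable.
  For a prime \<open>P\<close>, both \<open>P[X]\<close> and \<open>P[[X]]\<close> are prime; passing to coefficients commutes with
  intersections, and \<open>P\<close> is recovered from the constant polynomials in \<open>P[X]\<close>, so incomparability
  is preserved. Hence \<open>I\<close>, \<open>I[X]\<close> and \<open>I[[X]]\<close> are intersections of the same number of
  incomparable primes. If \<open>I\<close> is the whole ring, this number is \<open>0\<close> and all three absorbing numbers
  are infinite, because only proper ideals are absorbing.
\<close>

section \<open>Sums and products in ideals\<close>

lemma (in ideal) finsum_mem: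
  "(\<And>i. i \<in> A \<Longrightarrow> f i \<in> I) \<Longrightarrow> (\<Oplus>i\<in>A. f i) \<in> I"
proof (induction A rule: infinite_finite_induct)
  case (insert x F)
  then have "f \<in> F \<rightarrow> carrier R" "f x \<in> carrier R"
    using Icarr by blast+
  with insert show ?case by simp
qed auto

text \<open>
  Modulo the ideal the sum is its single exceptional term. This is used for the sums that
  separate primes, and for the coefficients of a product of power series.
\<close>

lemma (in ideal) finsum_mem_iff_term_mem:
  assumes "finite A" "j \<in> A" "f \<in> A \<rightarrow> carrier R"
    and "\<And>i. i \<in> A \<Longrightarrow> i \<noteq> j \<Longrightarrow> f i \<in> I"
  shows "(\<Oplus>i\<in>A. f i) \<in> I \<longleftrightarrow> f j \<in> I"
proof -
  let ?s = "\<Oplus>i\<in>A - {j}. f i"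
  have s: "?s \<in> I" using assms by (intro finsum_mem) auto
  have fj: "f j \<in> carrier R" using assms by auto
  have eq: "(\<Oplus>i\<in>A. f i) = f j \<oplus> ?s"
    using assms finsum_insert[of "A - {j}" j f] by (auto simp: insert_absorb Pi_iff)
  have "f j = (f j \<oplus> ?s) \<ominus> ?s"
    using fj Icarr[OF s] by algebra
  moreover have "\<ominus> ?s \<in> I"
    using s by (rule additive_subgroup.a_inv_closed[OF is_additive_subgroup])
  ultimately show ?thesis
    using s eq fj Icarr[OF s]
      additive_subgroup.a_closed[OF is_additive_subgroup, of "f j \<oplus> ?s" "\<ominus> ?s"]
      additive_subgroup.a_closed[OF is_additive_subgroup, of "f j" ?s]
    by (auto simp: minus_eq)
qed

lemma (in cring) finprod_mem_ideal:
  assumes "ideal I R" "finite A" "r \<in> A \<rightarrow> carrier R" "i \<in> A" "r i \<in> I"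
  shows "(\<Otimes>i\<in>A. r i) \<in> I"
proof -
  interpret I: ideal I R by fact
  have r: "r \<in> A - {i} \<rightarrow> carrier R" using assms by auto
  then have "(\<Otimes>i\<in>A. r i) = r i \<otimes> (\<Otimes>i\<in>A - {i}. r i)"
    using assms finprod_insert[of "A - {i}" i r] by (auto simp: insert_absorb)
  then show ?thesis
    using assms r by (simp add: I.I_r_closed)
qed

lemma (in primeideal) finprod_memE:
  assumes "finite A" "r \<in> A \<rightarrow> carrier R" "(\<Otimes>i\<in>A. r i) \<in> I"
  shows "\<exists>i\<in>A. r i \<in> I"
  using assms
proof (induction A)
  case empty
  then show ?case using one_imp_carrier I_notcarr by auto
next
  case (insert x F)
  then have "r x \<in> I \<or> (\<Otimes>i\<in>F. r i) \<in> I"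
    by (intro I_prime) auto
  then show ?case using insert by auto
qed

lemma (in primeideal) finprod_mem_iff:
  assumes "finite A" "r \<in> A \<rightarrow> carrier R"
  shows "(\<Otimes>i\<in>A. r i) \<in> I \<longleftrightarrow> (\<exists>i\<in>A. r i \<in> I)"
proof
  show "\<exists>i\<in>A. r i \<in> I" if "(\<Otimes>i\<in>A. r i) \<in> I"
    using assms that by (rule finprod_memE)
  show "(\<Otimes>i\<in>A. r i) \<in> I" if "\<exists>i\<in>A. r i \<in> I"
    using finprod_mem_ideal[OF is_ideal assms] that by auto
qed

section \<open>The absorbing number of an intersection of incomparable primes\<close>

definition prime_antichain :: "('a, 'm) ring_scheme \<Rightarrow> 'a set set \<Rightarrow> bool" where
  "prime_antichain R \<P> \<longleftrightarrow> finite \<P> \<and> (\<forall>P\<in>\<P>. primeideal P R) \<and>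
     (\<forall>P\<in>\<P>. \<forall>Q\<in>\<P>. P \<subseteq> Q \<longrightarrow> P = Q)"

text \<open>
  For each \<open>Q \<noteq> P\<close> there is an element of \<open>Q\<close> outside \<open>P\<close>; their product lies in every \<open>Q \<noteq> P\<close>, and
  stays outside \<open>P\<close> since \<open>P\<close> is prime.
\<close>

lemma (in cring) prime_antichain_separators:
  assumes "prime_antichain R \<P>"
  shows "\<exists>e. \<forall>P\<in>\<P>. e P \<in> carrier R \<and> (\<forall>Q\<in>\<P>. e P \<in> Q \<longleftrightarrow> Q \<noteq> P)"
proof (intro bchoice ballI)
  fix P assume P: "P \<in> \<P>"
  have fin: "finite \<P>" and pr: "\<And>P. P \<in> \<P> \<Longrightarrow> primeideal P R"
    using assms by (auto simp: prime_antichain_def)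
  have carr: "\<And>P x. P \<in> \<P> \<Longrightarrow> x \<in> P \<Longrightarrow> x \<in> carrier R"
    using pr primeideal.axioms(1) ideal.Icarr by metis
  have anti: "\<And>Q. Q \<in> \<P> - {P} \<Longrightarrow> \<not> Q \<subseteq> P"
    using assms P by (auto simp: prime_antichain_def)
  define f where "f Q = (SOME x. x \<in> Q - P)" for Q
  have f: "f Q \<in> Q \<and> f Q \<notin> P" if "Q \<in> \<P> - {P}" for Q
    using someI_ex[of "\<lambda>x. x \<in> Q - P"] anti[OF that] by (auto simp: f_def)
  let ?e = "\<Otimes>Q\<in>\<P> - {P}. f Q"
  have fc: "f \<in> \<P> - {P} \<rightarrow> carrier R"
  proof (rule Pi_I)
    fix Q assume Q: "Q \<in> \<P> - {P}"
    show "f Q \<in> carrier R" using f[OF Q] Q carr[of Q "f Q"] by simp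
  qed
  have "?e \<in> Q \<longleftrightarrow> Q \<noteq> P" if Q: "Q \<in> \<P>" for Q
  proof -
    have "?e \<in> Q \<longleftrightarrow> (\<exists>Q'\<in>\<P> - {P}. f Q' \<in> Q)"
      using fin fc by (intro primeideal.finprod_mem_iff[OF pr[OF Q]]) auto
    then show ?thesis using Q f by auto
  qed
  with fc show "\<exists>e. e \<in> carrier R \<and> (\<forall>Q\<in>\<P>. e \<in> Q \<longleftrightarrow> Q \<noteq> P)"
    by (intro exI[of _ ?e]) auto
qed

lemma (in cring) ideal_Inter_primes:
  assumes "prime_antichain R \<P>"
  shows "ideal (carrier R \<inter> \<Inter>\<P>) R"
proof -
  have "ideal (\<Inter>(insert (carrier R) \<P>)) R"
    using assms by (intro i_Intersect) (auto simp: prime_antichain_def oneideal primeideal_def)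
  then show ?thesis by simp
qed

text \<open>
  A product in the intersection has, for each prime, a factor lying in that prime. At most
  \<open>card \<P>\<close> factors are selected in this way, and their product is already in every prime.
\<close>

lemma (in cring) n_absorbing_card_primes:
  assumes \<P>: "prime_antichain R \<P>" and ne: "\<P> \<noteq> {}"
  shows "n_absorbing_ideal R (card \<P>) (carrier R \<inter> \<Inter>\<P>)"
  unfolding n_absorbing_ideal_def
proof (intro conjI allI impI)
  let ?I = "carrier R \<inter> \<Inter>\<P>"
  have fin: "finite \<P>" and pr: "\<And>P. P \<in> \<P> \<Longrightarrow> primeideal P R"
    using \<P> by (auto simp: prime_antichain_def)
  show "card \<P> > 0" using fin ne by (simp add: card_gt_0_iff)
  show "ideal ?I R" by (rule ideal_Inter_primes[OF \<P>])
  obtain P where P: "P \<in> \<P>" using ne by blast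
  interpret P: primeideal P R by (rule pr[OF P])
  show "?I \<noteq> carrier R" using P P.I_notcarr P.Icarr by blast
  fix r assume r: "r \<in> {1..card \<P> + 1} \<rightarrow> carrier R" "(\<Otimes>i\<in>{1..card \<P> + 1}. r i) \<in> ?I"
  have "\<exists>i\<in>{1..card \<P> + 1}. r i \<in> P" if "P \<in> \<P>" for P
    using r that by (intro primeideal.finprod_memE[OF pr]) auto
  then obtain g where g: "\<And>P. P \<in> \<P> \<Longrightarrow> g P \<in> {1..card \<P> + 1} \<and> r (g P) \<in> P"
    by metis
  have "card (g ` \<P>) \<le> card \<P>" using fin by (rule card_image_le)
  \<comment> \<open>Different primes may select the same factor, so the selection is padded to \<open>card \<P>\<close> factors.\<close>
  moreover have "g ` \<P> \<subseteq> {1..card \<P> + 1}" using g by blast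
  ultimately obtain S where S: "g ` \<P> \<subseteq> S" "S \<subseteq> {1..card \<P> + 1}" "card S = card \<P>"
    using exists_subset_between[of "g ` \<P>" "card \<P>" "{1..card \<P> + 1}"] by auto
  have finS: "finite S" using finite_subset[OF S(2)] by simp
  have rS: "r \<in> S \<rightarrow> carrier R" using S(2) r(1) by auto
  have "(\<Otimes>i\<in>S. r i) \<in> P" if "P \<in> \<P>" for P
    using g[OF that] S that finS rS pr[OF that]
    by (intro finprod_mem_ideal[where i = "g P"]) (auto simp: primeideal_def)
  with S rS show "\<exists>S\<subseteq>{1..card \<P> + 1}. card S = card \<P> \<and> (\<Otimes>i\<in>S. r i) \<in> ?I"
    by (intro exI[of _ S]) auto
qed

text \<open>
  With fewer than \<open>card \<P>\<close> allowed factors, distribute the primes over \<open>n + 1\<close> nonempty classes and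
  find elements \<open>r i\<close> lying in exactly the primes of the \<open>i\<close>-th class. The product of all of them is
  in every prime, while a product without \<open>r j\<close> avoids the primes of the \<open>j\<close>-th class. The elements
  are sums of the elements that separate each prime from the others.
\<close>

lemma (in cring) card_primes_le_of_n_absorbing:
  assumes \<P>: "prime_antichain R \<P>" and abs: "n_absorbing_ideal R n (carrier R \<inter> \<Inter>\<P>)"
  shows "card \<P> \<le> n"
proof (rule ccontr)
  assume "\<not> card \<P> \<le> n"
  then have lt: "n + 1 \<le> card \<P>" by simp
  let ?I = "carrier R \<inter> \<Inter>\<P>"
  have fin: "finite \<P>" and pr: "\<And>P. P \<in> \<P> \<Longrightarrow> primeideal P R"
    using \<P> by (auto simp: prime_antichain_def)
  obtain e where e: "\<And>P. P \<in> \<P> \<Longrightarrow> e P \<in> carrier R"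
      "\<And>P Q. P \<in> \<P> \<Longrightarrow> Q \<in> \<P> \<Longrightarrow> e P \<in> Q \<longleftrightarrow> Q \<noteq> P"
    using prime_antichain_separators[OF \<P>] by metis
  obtain \<Q> where \<Q>: "\<Q> \<subseteq> \<P>" "card \<Q> = n + 1"
    using lt obtain_subset_with_card_n by metis
  then have finQ: "finite \<Q>" using fin finite_subset by blast
  obtain h where h: "bij_betw h {1..n + 1} \<Q>"
    using \<Q> finQ finite_same_card_bij[of "{1..n + 1}" \<Q>] by auto
  \<comment> \<open>A map of \<open>\<P>\<close> onto \<open>{1..n + 1}\<close>: it inverts \<open>h\<close>, and the remaining primes go to the first class.\<close>
  define g where "g P = (if P \<in> \<Q> then the_inv_into {1..n + 1} h P else 1)" for P
  have gh: "g (h i) = i" "h i \<in> \<P>" if "i \<in> {1..n + 1}" for i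
    using that h \<Q> by (auto simp: g_def bij_betw_def the_inv_into_f_f)
  have g: "g P \<in> {1..n + 1}" if "P \<in> \<P>" for P
  proof (cases "P \<in> \<Q>")
    case True
    then obtain i where "i \<in> {1..n + 1}" "P = h i"
      using h by (auto simp: bij_betw_def)
    then show ?thesis using gh by simp
  qed (simp add: g_def)
  \<comment> \<open>Modulo \<open>P\<close> only the separator \<open>e P\<close> survives, and it occurs in \<open>r i\<close> unless \<open>g P = i\<close>.\<close>
  define r where "r i = (\<Oplus>P\<in>{P \<in> \<P>. g P \<noteq> i}. e P)" for i
  have rc: "r i \<in> carrier R" for i
    unfolding r_def using e by (intro finsum_closed) auto
  have r_iff: "r i \<in> P \<longleftrightarrow> g P = i" if "P \<in> \<P>" for i P
  proof -
    interpret P: primeideal P R by (rule pr[OF that])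
    show ?thesis
    proof (cases "g P = i")
      case True
      then show ?thesis
        unfolding r_def using e(2) that by (auto intro!: P.finsum_mem)
    next
      case False
      then have "r i \<in> P \<longleftrightarrow> e P \<in> P"
        unfolding r_def using e that fin by (intro P.finsum_mem_iff_term_mem) auto
      then show ?thesis using False e(2) that by blast
    qed
  qed
  have "(\<Otimes>i\<in>{1..n + 1}. r i) \<in> P" if "P \<in> \<P>" for P
    using that g r_iff rc pr[OF that]
    by (intro finprod_mem_ideal[where i = "g P"]) (auto simp: primeideal_def)
  then have "(\<Otimes>i\<in>{1..n + 1}. r i) \<in> ?I" using rc by auto
  then obtain S where S: "S \<subseteq> {1..n + 1}" "card S = n" "(\<Otimes>i\<in>S. r i) \<in> ?I"
    using abs rc unfolding n_absorbing_ideal_def by blast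
  have "S \<noteq> {1..n + 1}"
  proof
    assume "S = {1..n + 1}"
    then have "card S = n + 1" by simp
    with S(2) show False by simp
  qed
  then obtain j where j: "j \<in> {1..n + 1}" "j \<notin> S" using S(1) by blast
  have "h j \<in> \<P>" using gh(2) j(1) by blast
  moreover have "finite S" using finite_subset[OF S(1)] by simp
  ultimately have "\<exists>i\<in>S. r i \<in> h j"
    using S(3) rc by (intro primeideal.finprod_memE[OF pr]) auto
  then show False using r_iff[OF \<open>h j \<in> \<P>\<close>] gh(1)[OF j(1)] j(2) by auto
qed

text \<open>
  The empty family stands for the ideal \<open>carrier R\<close>, which is not proper and therefore not
  \<open>n\<close>-absorbing for any \<open>n\<close>.
\<close>

theorem (in cring) absorbing_number_Inter_primes:
  assumes "prime_antichain R \<P>"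
  shows "absorbing_number R (carrier R \<inter> \<Inter>\<P>) = (if \<P> = {} then \<infinity> else enat (card \<P>))"
proof (cases "\<P> = {}")
  case True
  then show ?thesis by (simp add: absorbing_number_def n_absorbing_ideal_def)
next
  case False
  note abs = n_absorbing_card_primes[OF assms False]
  have "(LEAST n. n_absorbing_ideal R n (carrier R \<inter> \<Inter>\<P>)) = card \<P>"
    using abs card_primes_le_of_n_absorbing[OF assms] by (intro Least_equality)
  with abs False show ?thesis by (auto simp: absorbing_number_def)
qed

text \<open>
  The abstract form of the transfer: an extension of ideals that keeps primes prime, reflects
  inclusions between them and commutes with intersections turns an antichain of primes into an
  antichain of the same size.
\<close>

lemma absorbing_number_extension:
  assumes "cring R" "cring S" and \<P>: "prime_antichain R \<P>"
    and prime: "\<And>P. primeideal P R \<Longrightarrow> primeideal (E P) S"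
    and reflect: "\<And>P Q. primeideal P R \<Longrightarrow> primeideal Q R \<Longrightarrow> E P \<subseteq> E Q \<Longrightarrow> P \<subseteq> Q"
    and Inter: "E (carrier R \<inter> \<Inter>\<P>) = carrier S \<inter> (\<Inter>P\<in>\<P>. E P)"
  shows "absorbing_number S (E (carrier R \<inter> \<Inter>\<P>)) = absorbing_number R (carrier R \<inter> \<Inter>\<P>)"
proof -
  have pr: "\<And>P. P \<in> \<P> \<Longrightarrow> primeideal P R"
    and anti: "\<And>P Q. P \<in> \<P> \<Longrightarrow> Q \<in> \<P> \<Longrightarrow> P \<subseteq> Q \<Longrightarrow> P = Q"
    using \<P> unfolding prime_antichain_def by blast+
  have *: "E P \<subseteq> E Q \<Longrightarrow> P = Q" if "P \<in> \<P>" "Q \<in> \<P>" for P Q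
    using anti[OF that] reflect[OF pr[OF that(1)] pr[OF that(2)]] by blast
  then have "inj_on E \<P>" by (intro inj_onI) auto
  then have card: "card (E ` \<P>) = card \<P>" by (rule card_image)
  have "prime_antichain S (E ` \<P>)"
    unfolding prime_antichain_def
  proof (intro conjI ballI impI)
    show "finite (E ` \<P>)" using \<P> by (simp add: prime_antichain_def)
    show "primeideal P S" if "P \<in> E ` \<P>" for P using that prime pr by auto
    show "P = Q" if "P \<in> E ` \<P>" "Q \<in> E ` \<P>" "P \<subseteq> Q" for P Q using that * by auto
  qed
  from cring.absorbing_number_Inter_primes[OF assms(2) this]
  show ?thesis
    using cring.absorbing_number_Inter_primes[OF assms(1) \<P>] by (simp add: Inter card)
qed

section \<open>Radical ideals of Noetherian rings\<close>

definition colon :: "('a, 'm) ring_scheme \<Rightarrow> 'a set \<Rightarrow> 'a set \<Rightarrow> 'a set" where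
  "colon R I A = {x \<in> carrier R. \<forall>a\<in>A. x \<otimes>\<^bsub>R\<^esub> a \<in> I}"

lemma (in cring) colon_ideal:
  assumes "ideal I R" "A \<subseteq> carrier R"
  shows "ideal (colon R I A) R"
proof -
  interpret I: ideal I R by fact
  have carr: "a \<in> A \<Longrightarrow> a \<in> carrier R" for a using assms by auto
  have l: "y \<otimes> x \<in> colon R I A" if "x \<in> colon R I A" "y \<in> carrier R" for x y
    using that carr by (auto simp: colon_def m_assoc I.I_l_closed)
  show ?thesis
  proof (rule idealI)
    show "subgroup (colon R I A) (add_monoid R)"
    proof (rule a_group[THEN group.subgroupI])
      have "\<zero> \<in> colon R I A" using carr by (auto simp: colon_def)
      then show "colon R I A \<noteq> {}" by blast
      show "inv\<^bsub>add_monoid R\<^esub> x \<in> colon R I A" if "x \<in> colon R I A" for x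
      proof -
        have "\<ominus> x \<in> colon R I A" using that carr by (auto simp: colon_def l_minus)
        then show ?thesis by (simp only: a_inv_def)
      qed
    qed (use carr in \<open>auto simp: colon_def l_distr\<close>)
    show "x \<otimes> y \<in> colon R I A" if "x \<in> colon R I A" "y \<in> carrier R" for x y
      using l[OF that] that m_comm[of x y] by (simp add: colon_def)
  qed (use l ring_axioms in auto)
qed

text \<open>
  This is another description of radical ideals. Asking for squares only makes it easy to verify
  for colon ideals.
\<close>

definition semiprime_ideal :: "'a set \<Rightarrow> ('a, 'm) ring_scheme \<Rightarrow> bool" where
  "semiprime_ideal I R \<longleftrightarrow> ideal I R \<and> (\<forall>x\<in>carrier R. x \<otimes>\<^bsub>R\<^esub> x \<in> I \<longrightarrow> x \<in> I)"

lemma (in cring) radical_ideal_imp_semiprime: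
  assumes "radical_ideal I R"
  shows "semiprime_ideal I R"
  unfolding semiprime_ideal_def
proof (intro conjI ballI impI)
  show "ideal I R" using assms by (simp add: radical_ideal_def)
  fix x assume x: "x \<in> carrier R" "x \<otimes> x \<in> I"
  then have "x [^] (2::nat) \<in> I" by (simp add: numeral_2_eq_2)
  then have "x \<in> ideal_radical R I"
    using x unfolding ideal_radical_def by (intro CollectI conjI exI[of _ "2::nat"]) auto
  then show "x \<in> I" using assms by (simp add: radical_ideal_def)
qed

text \<open>
  If \<open>x \<otimes> x\<close> multiplies \<open>a\<close> into \<open>I\<close>, then the square of \<open>x \<otimes> a\<close> is in \<open>I\<close>, hence \<open>x \<otimes> a\<close> is.
\<close>

lemma (in cring) semiprime_colon:
  assumes "semiprime_ideal I R" "A \<subseteq> carrier R"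
  shows "semiprime_ideal (colon R I A) R"
  unfolding semiprime_ideal_def
proof (intro conjI ballI impI)
  interpret I: ideal I R using assms by (simp add: semiprime_ideal_def)
  show "ideal (colon R I A) R" using assms by (simp add: colon_ideal I.is_ideal)
  fix x assume x: "x \<in> carrier R" "x \<otimes> x \<in> colon R I A"
  have "x \<otimes> a \<in> I" if "a \<in> A" for a
  proof -
    have a: "a \<in> carrier R" "(x \<otimes> x) \<otimes> a \<in> I" using that x assms by (auto simp: colon_def)
    have "(x \<otimes> a) \<otimes> (x \<otimes> a) = ((x \<otimes> x) \<otimes> a) \<otimes> a"
      using x(1) a(1) by (metis m_assoc m_comm m_closed)
    moreover have "((x \<otimes> x) \<otimes> a) \<otimes> a \<in> I" by (rule I.I_r_closed[OF a(2,1)])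
    moreover have "x \<otimes> a \<in> carrier R" using x(1) a(1) by simp
    ultimately show ?thesis using assms(1) unfolding semiprime_ideal_def by metis
  qed
  with x show "x \<in> colon R I A" by (simp add: colon_def)
qed

text \<open>
  Let \<open>M\<close> be maximal among the semiprime ideals without such a decomposition. It is neither
  prime nor the whole ring, so there are \<open>a, b \<notin> M\<close> with \<open>a \<otimes> b \<in> M\<close>. The colon ideals
  \<open>J = (M : a)\<close> and \<open>K = (M : J)\<close> are semiprime and strictly larger than \<open>M\<close>, since \<open>b \<in> J\<close> and
  \<open>a \<in> K\<close>; so both decompose. An element of both has its square in \<open>M\<close>, which gives
  \<open>M = J \<inter> K\<close>, and \<open>M\<close> decomposes after all.
\<close>

lemma (in cring) noetherian_semiprime_Inter_primes:
  assumes noeth: "noetherian_ring R" and I: "semiprime_ideal I R"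
  shows "\<exists>\<P>. finite \<P> \<and> (\<forall>P\<in>\<P>. primeideal P R) \<and> I = carrier R \<inter> \<Inter>\<P>"
proof (rule ccontr)
  define dec where
    "dec J \<longleftrightarrow> (\<exists>\<P>. finite \<P> \<and> (\<forall>P\<in>\<P>. primeideal P R) \<and> J = carrier R \<inter> \<Inter>\<P>)" for J
  have decI: "dec J" if "finite \<P>" "\<And>P. P \<in> \<P> \<Longrightarrow> primeideal P R" "J = carrier R \<inter> \<Inter>\<P>" for J \<P>
    unfolding dec_def using that by (intro exI[of _ \<P>]) simp
  assume "\<nexists>\<P>. finite \<P> \<and> (\<forall>P\<in>\<P>. primeideal P R) \<and> I = carrier R \<inter> \<Inter>\<P>"
  then have "\<not> dec I" by (simp add: dec_def)
  let ?B = "{I. semiprime_ideal I R \<and> \<not> dec I}"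
  have "\<exists>M\<in>?B. \<forall>J\<in>?B. M \<subseteq> J \<longrightarrow> J = M"
  proof (rule subset_Zorn_nonempty)
    show "?B \<noteq> {}" using I \<open>\<not> dec I\<close> by blast
    fix \<C> assume C: "\<C> \<noteq> {}" "subset.chain ?B \<C>"
    then have "subset.chain {I. ideal I R} \<C>"
      by (auto simp: pred_on.chain_def semiprime_ideal_def)
    then have "\<Union>\<C> \<in> \<C>" using noetherian_ring.ideal_chain_is_trivial[OF noeth C(1)] by blast
    then show "\<Union>\<C> \<in> ?B" using C(2) unfolding pred_on.chain_def by blast
  qed
  then obtain M where M: "semiprime_ideal M R" "\<not> dec M"
    and max: "\<And>J. semiprime_ideal J R \<Longrightarrow> M \<subset> J \<Longrightarrow> dec J"
    by blast
  interpret M: ideal M R using M by (simp add: semiprime_ideal_def)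
  have "\<not> primeideal M R"
  proof
    assume "primeideal M R"
    then have "dec M" using M.Icarr by (intro decI[of "{M}"]) auto
    with M(2) show False by simp
  qed
  moreover have "carrier R \<noteq> M"
  proof
    assume "carrier R = M"
    then have "dec M" by (intro decI[of "{}"]) auto
    with M(2) show False by simp
  qed
  ultimately obtain a b where ab: "a \<in> carrier R" "b \<in> carrier R" "a \<otimes> b \<in> M" "a \<notin> M" "b \<notin> M"
    using M.primeidealCE[OF is_cring] by metis
  define J where "J = colon R M {a}"
  define K where "K = colon R M J"
  have Jc: "J \<subseteq> carrier R" by (auto simp: J_def colon_def)
  have "semiprime_ideal J R" "semiprime_ideal K R"
    unfolding J_def K_def using semiprime_colon[OF M(1)] ab Jc by (auto simp: J_def)
  moreover have MJ: "M \<subseteq> J"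
    using ab by (auto simp: J_def colon_def M.Icarr M.I_r_closed)
  moreover have "b \<in> J" using ab by (simp add: J_def colon_def m_comm)
  moreover have MK: "M \<subseteq> K"
    using Jc by (auto simp: K_def colon_def M.Icarr intro!: M.I_r_closed)
  moreover have "a \<in> K" using ab by (auto simp: K_def J_def colon_def m_comm)
  ultimately have "dec J" "dec K" using max[of J] max[of K] ab by blast+
  then obtain \<P> \<Q> where PQ: "finite \<P>" "\<forall>P\<in>\<P>. primeideal P R" "J = carrier R \<inter> \<Inter>\<P>"
    "finite \<Q>" "\<forall>P\<in>\<Q>. primeideal P R" "K = carrier R \<inter> \<Inter>\<Q>"
    unfolding dec_def by (elim exE conjE)
  have "J \<inter> K \<subseteq> M"
  proof
    fix x assume "x \<in> J \<inter> K"
    then have "x \<in> carrier R" "x \<otimes> x \<in> M" by (auto simp: K_def colon_def)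
    then show "x \<in> M" using M(1) unfolding semiprime_ideal_def by blast
  qed
  with MJ MK have "M = J \<inter> K" by auto
  then have "M = carrier R \<inter> \<Inter>(\<P> \<union> \<Q>)"
    unfolding PQ(3) PQ(6) by auto
  then have "dec M" using PQ(1,2,4,5) by (intro decI[of "\<P> \<union> \<Q>"]) auto
  with M(2) show False by simp
qed

lemma prime_antichain_minimal_elements:
  assumes "finite \<P>" "\<And>P. P \<in> \<P> \<Longrightarrow> primeideal P R"
  shows "\<exists>\<Q>. prime_antichain R \<Q> \<and> \<Inter>\<Q> = \<Inter>\<P>"
proof (intro exI conjI)
  let ?Q = "{P \<in> \<P>. \<forall>Q\<in>\<P>. Q \<subseteq> P \<longrightarrow> Q = P}"
  show "prime_antichain R ?Q" using assms by (auto simp: prime_antichain_def)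
  have "\<exists>Q\<in>?Q. Q \<subseteq> P" if "P \<in> \<P>" for P
    using finite_has_minimal2[OF assms(1) that] by auto
  then show "\<Inter>?Q = \<Inter>\<P>" by blast
qed

section \<open>Extending primes to polynomials and power series\<close>

lemma mem_power_series_ring: "p \<in> carrier (power_series_ring R) \<longleftrightarrow> (\<forall>i. p i \<in> carrier R)"
  by (auto simp: power_series_ring_def)

lemma (in ideal) mem_power_series_ideal: "p \<in> power_series_ideal R I \<longleftrightarrow> (\<forall>i. p i \<in> I)"
  by (auto simp: power_series_ideal_def mem_power_series_ring Icarr)

text \<open>
  If \<open>p i\<close> and \<open>q j\<close> are the first coefficients of \<open>p\<close> and \<open>q\<close> outside the prime, then the
  coefficient of the product at \<open>i + j\<close> is congruent to \<open>p i \<otimes> q j\<close>: in any other term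
  \<open>p k \<otimes> q (i + j - k)\<close>, one of the indices falls below \<open>i\<close> or \<open>j\<close> respectively.
\<close>

lemma (in primeideal) primeideal_power_series:
  "primeideal (power_series_ideal R I) (power_series_ring R)"
proof (rule primeidealI)
  let ?S = "power_series_ring R"
  show "ideal (power_series_ideal R I) ?S"
    by (rule power_series_ideal_ideal[OF is_ideal])
  show "cring ?S" by (rule power_series_ring_cring)
  have "\<one> \<notin> I" using one_imp_carrier I_notcarr by blast
  then have "\<one>\<^bsub>?S\<^esub> \<notin> power_series_ideal R I"
    by (auto simp: power_series_ring_def mem_power_series_ideal intro!: exI[of _ 0])
  moreover have "\<one>\<^bsub>?S\<^esub> \<in> carrier ?S" by (simp add: power_series_ring_def)
  ultimately show "carrier ?S \<noteq> power_series_ideal R I" by blast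
  fix p q assume pq: "p \<in> carrier ?S" "q \<in> carrier ?S" "p \<otimes>\<^bsub>?S\<^esub> q \<in> power_series_ideal R I"
  have c: "p i \<in> carrier R" "q i \<in> carrier R" for i using pq by (auto simp: mem_power_series_ring)
  show "p \<in> power_series_ideal R I \<or> q \<in> power_series_ideal R I"
  proof (rule ccontr)
    assume "\<not> ?thesis"
    then have ex: "\<exists>i. p i \<notin> I" "\<exists>j. q j \<notin> I" by (auto simp: mem_power_series_ideal)
    define i where "i = (LEAST i. p i \<notin> I)"
    define j where "j = (LEAST j. q j \<notin> I)"
    have ij: "p i \<notin> I" "q j \<notin> I"
      using LeastI_ex[OF ex(1)] LeastI_ex[OF ex(2)] by (simp_all add: i_def j_def)
    have lt: "\<And>k. k < i \<Longrightarrow> p k \<in> I" "\<And>k. k < j \<Longrightarrow> q k \<in> I"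
      unfolding i_def j_def using not_less_Least by blast+
    have "(\<Oplus>k\<in>{..i + j}. p k \<otimes> q (i + j - k)) \<in> I"
      using pq(3) by (simp add: mem_power_series_ideal) (simp add: power_series_ring_def)
    also have "?this \<longleftrightarrow> p i \<otimes> q (i + j - i) \<in> I"
    proof (rule finsum_mem_iff_term_mem)
      fix k assume k: "k \<in> {..i + j}" "k \<noteq> i"
      then consider "k < i" | "i + j - k < j" by fastforce
      then show "p k \<otimes> q (i + j - k) \<in> I"
        using c lt by cases (auto intro: I_l_closed I_r_closed)
    qed (use c in auto)
    finally show False using I_prime[of "p i" "q j"] c ij by auto
  qed
qed

context cring
begin

lemma UP_incl_ring_hom: "(\<lambda>p. p) \<in> ring_hom (UP R) (power_series_ring R)"
  by (auto simp: ring_hom_def UP_def power_series_ring_def)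

lemma poly_ideal_eq: "poly_ideal R I = {p \<in> carrier (UP R). p \<in> power_series_ideal R I}"
  by (auto simp: poly_ideal_def power_series_ideal_def UP_def mem_power_series_ring)

lemma UP_is_cring: "cring (UP R)"
proof -
  interpret UP_cring R "UP R" by unfold_locales
  show ?thesis by (rule UP_cring)
qed

text \<open>
  \<open>P[X]\<close> is the preimage of \<open>P[[X]]\<close> under the inclusion of the polynomials in the power series.
\<close>

lemma primeideal_poly:
  assumes "primeideal P R"
  shows "primeideal (poly_ideal R P) (UP R)"
proof -
  interpret h: ring_hom_ring "UP R" "power_series_ring R" "\<lambda>p. p"
    using UP_is_cring power_series_ring_cring UP_incl_ring_hom
    by (intro ring_hom_ringI2) (auto simp: cring_def)
  show ?thesis
    unfolding poly_ideal_eq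
    using h.primeideal_vimage[OF UP_is_cring primeideal.primeideal_power_series[OF assms]] .
qed

definition const_poly :: "'a \<Rightarrow> nat \<Rightarrow> 'a" where
  "const_poly a = (\<lambda>i. if i = 0 then a else \<zero>)"

lemma const_poly_mem_poly_ideal:
  assumes "ideal I R" "a \<in> carrier R"
  shows "const_poly a \<in> poly_ideal R I \<longleftrightarrow> a \<in> I"
proof -
  interpret I: ideal I R by fact
  have "const_poly a \<in> carrier (UP R)"
    using assms by (auto simp: const_poly_def UP_def up_def intro!: exI[of _ 0] bound.intro)
  then show ?thesis
    by (auto simp: poly_ideal_eq I.mem_power_series_ideal const_poly_def)
qed

lemma poly_ideal_reflects_subset:
  assumes "ideal I R" "ideal J R" "poly_ideal R I \<subseteq> poly_ideal R J"
  shows "I \<subseteq> J"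
  using assms const_poly_mem_poly_ideal ideal.Icarr by (metis subset_iff)

lemma power_series_ideal_Inter:
  "power_series_ideal R (carrier R \<inter> \<Inter>\<P>) =
     carrier (power_series_ring R) \<inter> (\<Inter>P\<in>\<P>. power_series_ideal R P)"
  by (auto simp: power_series_ideal_def mem_power_series_ring)

lemma poly_ideal_Inter:
  "poly_ideal R (carrier R \<inter> \<Inter>\<P>) = carrier (UP R) \<inter> (\<Inter>P\<in>\<P>. poly_ideal R P)"
proof -
  have "carrier (UP R) \<subseteq> carrier (power_series_ring R)"
    using UP_incl_ring_hom by (auto simp: ring_hom_def)
  then show ?thesis
    unfolding poly_ideal_eq power_series_ideal_Inter by blast
qed

end

section \<open>The absorbing numbers of the extensions of a radical ideal\<close>

theorem corollary25:
  fixes R :: "('a, 'm) ring_scheme" and I :: "'a set"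
  assumes "cring R"
    and "torsion_free_ring R"
    and "noetherian_ring R"
    and "radical_ideal I R"
  shows "absorbing_number (power_series_ring R) (power_series_ideal R I)
           = absorbing_number (UP R) (poly_ideal R I)
       \<and> absorbing_number (UP R) (poly_ideal R I) = absorbing_number R I"
proof -
  interpret cring R by fact
  obtain \<P> where "finite \<P>" "\<And>P. P \<in> \<P> \<Longrightarrow> primeideal P R" "I = carrier R \<inter> \<Inter>\<P>"
    using noetherian_semiprime_Inter_primes[OF assms(3) radical_ideal_imp_semiprime[OF assms(4)]]
    by metis
  then obtain \<Q> where Q: "prime_antichain R \<Q>" and I: "I = carrier R \<inter> \<Inter>\<Q>"
    using prime_antichain_minimal_elements by metis
  have "absorbing_number (UP R) (poly_ideal R I) = absorbing_number R I"
    unfolding I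
    by (rule absorbing_number_extension[OF assms(1) UP_is_cring Q])
      (auto simp: primeideal_poly poly_ideal_Inter
            dest: poly_ideal_reflects_subset[OF primeideal.axioms(1) primeideal.axioms(1)])
  moreover have "absorbing_number (power_series_ring R) (power_series_ideal R I) = absorbing_number R I"
    unfolding I
  proof (rule absorbing_number_extension[OF assms(1) power_series_ring_cring Q])
    fix P Q assume PQ: "primeideal P R" "primeideal Q R"
      "power_series_ideal R P \<subseteq> power_series_ideal R Q"
    then have "poly_ideal R P \<subseteq> poly_ideal R Q" by (auto simp: poly_ideal_eq)
    then show "P \<subseteq> Q" using PQ poly_ideal_reflects_subset primeideal.axioms(1) by metis
  qed (simp_all add: primeideal.primeideal_power_series power_series_ideal_Inter)
  ultimately show ?thesis by simp
qed

end
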